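(* Let $K$ and $L$ be compact Hausdorff spaces and let $T:C(K)\to C(L)$ be a positive isomorphic embedding. Then the family of those nonempty open $U\subseteq K$ such that $\overline{U}\in ci(L)$ is a $\pi$-base of $K$.
   Context: $C(K)$ is the Banach space of real-valued continuous functions on $K$ with the supremum norm. An isomorphic embedding $T:C(K)\to C(L)$ is a linear operator (not necessarily surjective) for which there are constants $m_1,m_2>0$ with $m_1\|g\|\le\|Tg\|\le m_2\|g\|$ for all $g\in C(K)$. $T$ is positive if $g\ge 0$ implies $Tg\ge 0$. $ci(L)$ denotes the class of compact spaces that are continuous images of closed subspaces of $L$. A $\pi$-base of $K$ is a family of nonempty open subsets of $K$ such that every nonempty open subset of $K$ contains a member of the family. *)

theory Defs
  imports "HOL-Analysis.Analysis"
begin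

text \<open>
  For a compact space \<open>'a\<close>, every real-valued continuous function is bounded, so the library
  type \<open>'a \<Rightarrow>\<^sub>C real\<close> of bounded continuous functions with the supremum norm is \<open>C(K)\<close>.
\<close>

definition isomorphic_embedding ::
  "('v::real_normed_vector \<Rightarrow> 'w::real_normed_vector) \<Rightarrow> bool" where
  "isomorphic_embedding T \<longleftrightarrow>
     linear T \<and>
     (\<exists>m1 m2. m1 > 0 \<and> m2 > 0 \<and> (\<forall>g. m1 * norm g \<le> norm (T g) \<and> norm (T g) \<le> m2 * norm g))"

definition positive_operator ::
  "(('a::topological_space \<Rightarrow>\<^sub>C real) \<Rightarrow> ('b::topological_space \<Rightarrow>\<^sub>C real)) \<Rightarrow> bool" where
  "positive_operator T \<longleftrightarrow>
     (\<forall>g. (\<forall>x. 0 \<le> apply_bcontfun g x) \<longrightarrow> (\<forall>y. 0 \<le> apply_bcontfun (T g) y))"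

text \<open>\<open>ci(L)\<close> is a class of spaces of arbitrary size, hence encoded as a predicate on topologies.\<close>

definition in_ci :: "'a topology \<Rightarrow> 'b topology \<Rightarrow> bool" where
  "in_ci X L \<longleftrightarrow>
     compact_space X \<and>
     (\<exists>F f. closedin L F \<and> continuous_map (subtopology L F) X f \<and> f ` F = topspace X)"

definition pi_base :: "'a::topological_space set set \<Rightarrow> bool" where
  "pi_base \<B> \<longleftrightarrow>
     (\<forall>U\<in>\<B>. open U \<and> U \<noteq> {}) \<and>
     (\<forall>V. open V \<and> V \<noteq> {} \<longrightarrow> (\<exists>U\<in>\<B>. U \<subseteq> V))"

end

theory Submission
  imports Defs
begin

text \<open>
  For \<open>y \<in> L\<close> the functional \<open>g \<mapsto> T g y\<close> is integration against a positive measure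
  \<open>\<mu>\<^sub>y\<close> on \<open>K\<close>. With \<open>m\<close> a lower bound for \<open>T\<close>, relate \<open>y\<close> to \<open>x\<close> when \<open>\<mu>\<^sub>y{x} \<ge> m\<close>, a condition
  expressed below by test functions alone. This relation \<open>R \<subseteq> L \<times> K\<close> is closed, and every \<open>x\<close>
  has a partner: a nonnegative \<open>g\<close> with \<open>g x \<ge> 1\<close> has norm at least 1, so \<open>T g\<close> is at
  least \<open>m\<close> somewhere; the sets where this happens are directed, and compactness of \<open>L\<close> gives a
  common point (\<open>atom_relation_covers\<close>).

  If the partners inside a closed set \<open>C\<close> are unique for all \<open>y\<close> in a closed \<open>F\<close>, and those
  partners exhaust \<open>C\<close>, then a closed graph makes \<open>C\<close> a continuous image of a closed subset of \<open>F\<close>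
  (\<open>in_ci_of_single_valued\<close>). So it suffices to find, inside a given open set, a smaller open set
  still covered by some \<open>F\<close>, on which partners are unique.

  Suppose \<open>V\<close> is covered by \<open>F\<close>, and take \<open>F\<close> minimal. If some \<open>y \<in> F\<close> has two partners in \<open>V\<close>,
  then, by continuity of the functions \<open>T g\<close>, the measures throughout a neighbourhood of \<open>y\<close>
  charge each of two disjoint open sets \<open>G1, G2 \<subseteq> V\<close> with mass more than \<open>m/2\<close>. By minimality
  this neighbourhood is indispensable: some nonempty open \<open>U \<subseteq> V\<close> has no partners in \<open>F\<close> outside
  it. After shrinking, \<open>U\<close> misses \<open>G1\<close> or \<open>G2\<close>, so passing from \<open>V\<close> to \<open>U\<close> costs every measure
  involved at least \<open>m/2\<close> (\<open>split_or_single_valued\<close>). As the masses are bounded at the start,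
  this happens only finitely often.
\<close>

section \<open>Continuous functions on a compact Hausdorff space\<close>

lemma bcontfun_of_continuous:
  fixes f :: "'a::topological_space \<Rightarrow> real"
  assumes "compact (UNIV :: 'a set)" and "continuous_on UNIV f"
  obtains g :: "'a \<Rightarrow>\<^sub>C real" where "\<And>z. g z = f z"
proof -
  have "f \<in> bcontfun"
    unfolding bcontfun_def using assms compact_continuous_image compact_imp_bounded by blast
  then obtain g :: "'a \<Rightarrow>\<^sub>C real" where "f = apply_bcontfun g" by (rule bcontfunE)
  with that show ?thesis by metis
qed

lemma norm_attained:
  fixes g :: "'a::topological_space \<Rightarrow>\<^sub>C real"
  assumes "compact (UNIV :: 'a set)"
  obtains y where "norm g \<le> \<bar>g y\<bar>"
proof -
  have "continuous_on UNIV (\<lambda>z. \<bar>g z\<bar>)" by (intro continuous_intros) simp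
  then obtain y where "\<And>z. \<bar>g z\<bar> \<le> \<bar>g y\<bar>"
    using continuous_attains_sup[OF assms, of "\<lambda>z. \<bar>g z\<bar>"] by auto
  then have "norm g \<le> \<bar>g y\<bar>" by (intro norm_bound) simp
  with that show ?thesis .
qed

lemma bump_function:
  fixes x :: "'a::t2_space"
  assumes "compact (UNIV :: 'a set)" and "open G" and "x \<in> G"
  obtains g :: "'a \<Rightarrow>\<^sub>C real"
  where "\<And>z. 0 \<le> g z" "\<And>z. g z \<le> 1" "g x = 1" "\<And>z. z \<notin> G \<Longrightarrow> g z = 0"
proof -
  have "Hausdorff_space (euclidean :: 'a topology)"
    unfolding Hausdorff_space_def using hausdorff[where 'a='a] by (auto simp: disjnt_def)
  then have normal: "normal_space (euclidean :: 'a topology)"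
    using assms(1) by (intro compact_Hausdorff_or_regular_imp_normal_space) (auto simp: compact_space_def)
  obtain f where f: "continuous_map (euclidean :: 'a topology) (top_of_set {0..1::real}) f"
      "f ` (- G) \<subseteq> {0}" "f ` {x} \<subseteq> {1}"
    using Urysohn_lemma[OF normal, of "- G" "{x}" 0 1] assms by (auto simp: closed_Compl disjnt_def)
  then have cont: "continuous_on UNIV f" and range: "\<And>z. f z \<in> {0..1}"
    by (auto simp: continuous_map_in_subtopology)
  obtain g :: "'a \<Rightarrow>\<^sub>C real" where "\<And>z. g z = f z"
    using bcontfun_of_continuous[OF assms(1) cont] by blast
  with f range show ?thesis by (intro that[of g]) (auto simp: image_subset_iff)
qed

lemma shrink_open:
  fixes x :: "'a::t2_space"
  assumes "compact (UNIV :: 'a set)" and "open V" and "x \<in> V"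
  obtains U where "open U" "x \<in> U" "closure U \<subseteq> V"
proof -
  obtain g :: "'a \<Rightarrow>\<^sub>C real" where g: "g x = 1" "\<And>z. z \<notin> V \<Longrightarrow> g z = 0"
    using bump_function[OF assms] by metis
  have "open {z. 1/2 < g z}" "closed {z. 1/2 \<le> g z}"
    by (auto intro!: open_Collect_less closed_Collect_le continuous_intros)
  moreover have "closure {z. 1/2 < g z} \<subseteq> {z. 1/2 \<le> g z}"
    by (rule closure_minimal) (use calculation in auto)
  moreover have "{z. 1/2 \<le> g z} \<subseteq> V" using g(2) by force
  ultimately show ?thesis using g(1) by (intro that[of "{z. 1/2 < g z}"]) auto
qed

text \<open>
  Directedness of the functions tested at \<open>x\<close>: take the minimum of 1 and the quotients
  \<open>g / g x\<close> with \<open>g x > 0\<close>.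
\<close>

lemma common_minorant:
  fixes x :: "'a::topological_space" and \<G> :: "('a \<Rightarrow>\<^sub>C real) set"
  assumes "compact (UNIV :: 'a set)" and "finite \<G>" and "\<And>g z. g \<in> \<G> \<Longrightarrow> 0 \<le> g z"
  obtains h :: "'a \<Rightarrow>\<^sub>C real"
  where "\<And>z. 0 \<le> h z" "h x = 1" "\<And>g z. g \<in> \<G> \<Longrightarrow> g x * h z \<le> g z"
proof -
  have "\<exists>h :: 'a \<Rightarrow>\<^sub>C real. (\<forall>z. 0 \<le> h z) \<and> h x = 1 \<and> (\<forall>g\<in>\<G>. \<forall>z. g x * h z \<le> g z)"
    using assms(2,3)
  proof (induction \<G>)
    case empty
    show ?case by (rule exI[of _ "const_bcontfun 1"]) simp
  next
    case (insert g \<G>)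
    then obtain h :: "'a \<Rightarrow>\<^sub>C real" where h: "\<forall>z. 0 \<le> h z" "h x = 1"
        "\<forall>f\<in>\<G>. \<forall>z. f x * h z \<le> f z" by auto
    have nonneg: "\<And>z. 0 \<le> g z" and nonneg': "\<And>f z. f \<in> \<G> \<Longrightarrow> 0 \<le> f z"
      using insert.prems by auto
    show ?case
    proof (cases "g x = 0")
      case True
      with h nonneg show ?thesis by auto
    next
      case False
      then have pos: "0 < g x" using nonneg[of x] by linarith
      have "continuous_on UNIV (\<lambda>z. min (h z) (g z / g x))"
        using False by (intro continuous_intros) auto
      then obtain h' :: "'a \<Rightarrow>\<^sub>C real" where h': "\<And>z. h' z = min (h z) (g z / g x)"
        using bcontfun_of_continuous[OF assms(1)] by blast
      have "f x * h' z \<le> f z" if "f \<in> insert g \<G>" for f z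
      proof (cases "f = g")
        case True
        have "h' z \<le> g z / g x" by (simp add: h')
        with pos True show ?thesis by (simp add: pos_le_divide_eq mult.commute)
      next
        case False
        then have "f \<in> \<G>" using that by simp
        have "f x * h' z \<le> f x * h z"
          using nonneg'[OF \<open>f \<in> \<G>\<close>] by (intro mult_left_mono) (auto simp: h')
        also have "\<dots> \<le> f z" using h(3) \<open>f \<in> \<G>\<close> by blast
        finally show ?thesis .
      qed
      moreover have "0 \<le> h' z" for z using h(1) nonneg pos by (simp add: h')
      moreover have "h' x = 1" using h(2) pos by (simp add: h')
      ultimately show ?thesis by blast
    qed
  qed
  with that show ?thesis by blast
qed

section \<open>Closed relations between compact spaces\<close>

lemma closed_relation_Image:
  fixes R :: "('a::t2_space \<times> 'b::t2_space) set"
  assumes "compact (UNIV :: 'a set)" "compact (UNIV :: 'b set)" and "closed R" "closed F"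
  shows "closed (R `` F)"
proof -
  have "compact (UNIV \<times> UNIV :: ('a \<times> 'b) set)" using assms(1,2) by (rule compact_Times)
  moreover have "closed ((F \<times> UNIV) \<inter> R)" using assms(3,4) by (intro closed_Int closed_Times) auto
  ultimately have "compact ((F \<times> UNIV) \<inter> R)"
    using compact_Int_closed[of UNIV] by simp
  then have "compact (snd ` ((F \<times> UNIV) \<inter> R))"
    by (intro compact_continuous_image continuous_intros)
  moreover have "snd ` ((F \<times> UNIV) \<inter> R) = R `` F" by force
  ultimately show ?thesis using compact_imp_closed by metis
qed

lemma closed_converse:
  fixes R :: "('a::topological_space \<times> 'b::topological_space) set"
  assumes "closed R"
  shows "closed (R\<inverse>)"
proof -
  have "R\<inverse> = prod.swap -` R" by auto
  moreover have "continuous_on UNIV (prod.swap :: 'b \<times> 'a \<Rightarrow> 'a \<times> 'b)"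
    by (simp add: prod.swap_def[abs_def] continuous_on_Pair continuous_on_fst continuous_on_snd)
  ultimately show ?thesis using assms by (simp add: closed_vimage)
qed

text \<open>
  A selection with closed graph and compact codomain is continuous: the preimage of a closed set
  under the selection is an image under the inverse relation.
\<close>

lemma in_ci_of_single_valued:
  fixes R :: "('l::t2_space \<times> 'k::t2_space) set"
  assumes "compact (UNIV :: 'l set)" "compact (UNIV :: 'k set)"
    and "closed R" "closed F" "closed C" and "C \<subseteq> R `` F"
    and single: "\<And>y x x'. y \<in> F \<Longrightarrow> (y, x) \<in> R \<Longrightarrow> (y, x') \<in> R \<Longrightarrow> x \<in> C \<Longrightarrow> x' \<in> C \<Longrightarrow> x = x'"
  shows "in_ci (top_of_set C) (euclidean :: 'l topology)"
proof -
  define D where "D = F \<inter> R\<inverse> `` C"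
  define f where "f y = (THE x. x \<in> C \<and> (y, x) \<in> R)" for y
  have f_eq: "f y = x" if "y \<in> F" "x \<in> C" "(y, x) \<in> R" for y x
    unfolding f_def by (rule the_equality) (use that single in blast)+
  have closed_preimage: "closed (F \<inter> R\<inverse> `` B)" if "closed B" for B
    using closed_relation_Image[OF assms(2,1) closed_converse[OF assms(3)] that] assms(4)
    by (rule closed_Int[rotated])
  have "closed D" unfolding D_def using assms(5) by (rule closed_preimage)
  have "continuous_on D f"
    unfolding continuous_on_closed_vimage[OF \<open>closed D\<close>]
  proof (intro allI impI)
    fix B :: "'k set"
    assume "closed B"
    have "f -` B \<inter> D = F \<inter> R\<inverse> `` (C \<inter> B)"
      unfolding D_def using f_eq by (fastforce)
    then show "closed (f -` B \<inter> D)"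
      using closed_preimage[of "C \<inter> B"] \<open>closed B\<close> assms(5) by auto
  qed
  moreover have image: "f ` D = C"
  proof
    show "f ` D \<subseteq> C" unfolding D_def using f_eq by auto
    show "C \<subseteq> f ` D"
    proof
      fix x assume "x \<in> C"
      then obtain y where "y \<in> F" "(y, x) \<in> R" using assms(6) by blast
      with \<open>x \<in> C\<close> show "x \<in> f ` D" unfolding D_def by (intro image_eqI[of x f y]) (auto simp: f_eq)
    qed
  qed
  ultimately have "continuous_map (top_of_set D) (top_of_set C) f"
    by (auto simp: continuous_map_in_subtopology)
  moreover have "compact C" using compact_Int_closed[OF assms(2,5)] by simp
  then have "compact_space (top_of_set C)" by (simp add: compact_space_subtopology)
  ultimately show ?thesis
    unfolding in_ci_def using \<open>closed D\<close> image by auto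
qed

text \<open>
  By compactness each fibre over a point of \<open>V\<close> meets the intersection of a chain of closed
  covering sets, so Zorn's lemma applies. It is used on the complements, which form unions.
\<close>

lemma minimal_closed_cover:
  fixes R :: "('l::t2_space \<times> 'k::t2_space) set"
  assumes "compact (UNIV :: 'l set)" "compact (UNIV :: 'k set)"
    and "closed R" "closed F" and "V \<subseteq> R `` F"
  obtains F0 where "closed F0" "F0 \<subseteq> F" "V \<subseteq> R `` F0"
    "\<And>E. closed E \<Longrightarrow> E \<subset> F0 \<Longrightarrow> \<not> V \<subseteq> R `` E"
proof -
  define \<A> where "\<A> = {W. open W \<and> - F \<subseteq> W \<and> V \<subseteq> R `` (- W)}"
  have "\<exists>M\<in>\<A>. \<forall>X\<in>\<A>. M \<subseteq> X \<longrightarrow> X = M"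
  proof (rule subset_Zorn_nonempty)
    have "- F \<in> \<A>" unfolding \<A>_def using assms(4,5) by (auto simp: open_Compl)
    then show "\<A> \<noteq> {}" by blast
  next
    fix \<C> assume "\<C> \<noteq> {}" and "subset.chain \<A> \<C>"
    then have sub: "\<C> \<subseteq> \<A>" and chain: "\<And>X Y. X \<in> \<C> \<Longrightarrow> Y \<in> \<C> \<Longrightarrow> X \<subseteq> Y \<or> Y \<subseteq> X"
      by (auto simp: subset_chain_def)
    have "x \<in> R `` (- \<Union>\<C>)" if "x \<in> V" for x
    proof -
      have fibre: "closed (R\<inverse> `` {x})"
        by (intro closed_relation_Image closed_converse assms) simp
      have "UNIV \<inter> (\<Inter>W\<in>\<C>. - W \<inter> R\<inverse> `` {x}) \<noteq> {}"
      proof (rule compact_imp_fip_image[OF assms(1)])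
        fix W assume "W \<in> \<C>"
        then have "closed (- W)" using sub by (auto simp: \<A>_def closed_Compl)
        then show "closed (- W \<inter> R\<inverse> `` {x})" using fibre by (rule closed_Int)
      next
        fix \<B> assume "finite \<B>" "\<B> \<subseteq> \<C>"
        show "UNIV \<inter> (\<Inter>W\<in>\<B>. - W \<inter> R\<inverse> `` {x}) \<noteq> {}"
        proof (cases "\<B> = {}")
          case False
          then have "\<Union>\<B> \<in> \<B>"
            using \<open>finite \<B>\<close> \<open>\<B> \<subseteq> \<C>\<close> chain by (intro Union_in_chain) (auto simp: subset_chain_def)
          then have "\<Union>\<B> \<in> \<A>" using sub \<open>\<B> \<subseteq> \<C>\<close> by (meson subsetD)
          then have "V \<subseteq> R `` (- \<Union>\<B>)" by (simp add: \<A>_def)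
          then have "x \<in> R `` (- \<Union>\<B>)" using \<open>x \<in> V\<close> by (rule subsetD)
          then obtain y where "y \<in> - \<Union>\<B>" "(y, x) \<in> R" by (rule ImageE)
          then have "y \<in> UNIV \<inter> (\<Inter>W\<in>\<B>. - W \<inter> R\<inverse> `` {x})" by auto
          then show ?thesis by (metis emptyE)
        qed simp
      qed
      with \<open>\<C> \<noteq> {}\<close> show ?thesis by auto
    qed
    moreover have "- F \<subseteq> \<Union>\<C>" using \<open>\<C> \<noteq> {}\<close> sub by (auto simp: \<A>_def)
    moreover have "open (\<Union>\<C>)" using sub by (auto simp: \<A>_def)
    ultimately show "\<Union>\<C> \<in> \<A>" by (auto simp: \<A>_def)
  qed
  then obtain M where M: "M \<in> \<A>" and max: "\<And>X. X \<in> \<A> \<Longrightarrow> M \<subseteq> X \<Longrightarrow> X = M" by blast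
  show ?thesis
  proof (rule that[of "- M"])
    fix E assume E: "closed E" "E \<subset> - M"
    show "\<not> V \<subseteq> R `` E"
    proof
      assume "V \<subseteq> R `` E"
      then have "- E \<in> \<A>" using E M by (auto simp: \<A>_def)
      then have "- E = M" using max E by blast
      with E show False by blast
    qed
  qed (use M in \<open>auto simp: \<A>_def\<close>)
qed

section \<open>Atoms of the measures attached to a positive embedding\<close>

text \<open>
  In terms of the measures \<open>\<mu>\<^sub>y\<close> representing \<open>g \<mapsto> T g y\<close>, this is the relation \<open>\<mu>\<^sub>y{x} \<ge> m\<close>,
  written as \<open>\<mu>\<^sub>y \<ge> m \<delta>\<^sub>x\<close>; in this form it is visibly closed.
\<close>

definition atom_relation ::
  "real \<Rightarrow> (('k::t2_space \<Rightarrow>\<^sub>C real) \<Rightarrow> ('l::t2_space \<Rightarrow>\<^sub>C real)) \<Rightarrow> ('l \<times> 'k) set" where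
  "atom_relation m T = {(y, x). \<forall>g. (\<forall>z. 0 \<le> apply_bcontfun g z) \<longrightarrow> m * g x \<le> T g y}"

text \<open>The condition \<open>\<mu>\<^sub>y(V) \<le> c\<close>; for open \<open>V\<close> the mass is a supremum over these test functions.\<close>

definition mass_le ::
  "(('k::t2_space \<Rightarrow>\<^sub>C real) \<Rightarrow> ('l::t2_space \<Rightarrow>\<^sub>C real)) \<Rightarrow> 'k set \<Rightarrow> 'l \<Rightarrow> real \<Rightarrow> bool" where
  "mass_le T V y c \<longleftrightarrow>
     (\<forall>g. (\<forall>z. 0 \<le> apply_bcontfun g z \<and> g z \<le> 1) \<and> (\<forall>z. z \<notin> V \<longrightarrow> g z = 0) \<longrightarrow> T g y \<le> c)"

lemma closed_atom_relation:
  fixes T :: "('k::t2_space \<Rightarrow>\<^sub>C real) \<Rightarrow> ('l::t2_space \<Rightarrow>\<^sub>C real)"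
  shows "closed (atom_relation m T)"
proof -
  have eq: "atom_relation m T =
      (\<Inter>g\<in>{g. \<forall>z. 0 \<le> apply_bcontfun g z}. {p. m * apply_bcontfun g (snd p) \<le> T g (fst p)})"
    by (auto simp: atom_relation_def)
  have "closed {p. m * g (snd p) \<le> T g (fst p)}" for g :: "'k \<Rightarrow>\<^sub>C real"
    by (intro closed_Collect_le continuous_intros
        continuous_on_compose2[OF continuous_on_apply_bcontfun[of UNIV]]) auto
  then show ?thesis unfolding eq by blast
qed

lemma positive_operator_mono:
  assumes "linear T" "positive_operator T" and "\<And>z. apply_bcontfun g z \<le> apply_bcontfun h z"
  shows "T g y \<le> T h y"
proof -
  have "0 \<le> T (h - g) y"
    using assms(2,3) unfolding positive_operator_def by simp
  then show ?thesis by (simp add: linear_diff[OF assms(1)])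
qed

lemma atom_relation_covers:
  fixes T :: "('k::t2_space \<Rightarrow>\<^sub>C real) \<Rightarrow> ('l::t2_space \<Rightarrow>\<^sub>C real)"
  assumes "compact (UNIV :: 'k set)" "compact (UNIV :: 'l set)"
    and "linear T" "positive_operator T"
    and "0 < m" and lower: "\<And>g. m * norm g \<le> norm (T g)"
  shows "\<exists>y. (y, x) \<in> atom_relation m T"
proof -
  let ?P = "{g :: 'k \<Rightarrow>\<^sub>C real. \<forall>z. 0 \<le> g z}"
  have "UNIV \<inter> (\<Inter>g\<in>?P. {y. m * apply_bcontfun g x \<le> T g y}) \<noteq> {}"
  proof (rule compact_imp_fip_image[OF assms(2)])
    show "closed {y. m * g x \<le> T g y}" for g :: "'k \<Rightarrow>\<^sub>C real"
      by (intro closed_Collect_le continuous_intros) simp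
  next
    fix \<G> assume "finite \<G>" "\<G> \<subseteq> ?P"
    then obtain h :: "'k \<Rightarrow>\<^sub>C real"
      where h: "\<And>z. 0 \<le> h z" "h x = 1" "\<And>g z. g \<in> \<G> \<Longrightarrow> g x * h z \<le> g z"
      using common_minorant[OF assms(1), of \<G> x] by blast
    obtain y where y: "norm (T h) \<le> \<bar>T h y\<bar>" using norm_attained[OF assms(2)] by blast
    have "1 \<le> norm h" using norm_bounded[of h x] h(2) by simp
    then have "m \<le> m * norm h" using \<open>0 < m\<close> by simp
    also have "\<dots> \<le> \<bar>T h y\<bar>" using lower[of h] y by linarith
    also have "\<dots> = T h y" using assms(4) h(1) by (simp add: positive_operator_def)
    finally have "m \<le> T h y" .
    have "m * g x \<le> T g y" if "g \<in> \<G>" for g :: "'k \<Rightarrow>\<^sub>C real"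
    proof -
      have "0 \<le> g x" using that \<open>\<G> \<subseteq> ?P\<close> by blast
      then have "m * g x \<le> T h y * g x" using \<open>m \<le> T h y\<close> by (rule mult_right_mono[rotated])
      also have "\<dots> = T (g x *\<^sub>R h) y"
        by (simp only: linear_scale[OF assms(3)] scaleR_bcontfun.rep_eq real_scaleR_def mult.commute[of "g x"])
      also have "\<dots> \<le> T g y"
        by (rule positive_operator_mono[OF assms(3,4)])
          (use h(3)[OF that] in simp)
      finally show ?thesis .
    qed
    then show "UNIV \<inter> (\<Inter>g\<in>\<G>. {y. m * apply_bcontfun g x \<le> T g y}) \<noteq> {}" by auto
  qed
  then show ?thesis by (auto simp: atom_relation_def)
qed

text \<open>A function living on \<open>U\<close> can be added to the bump \<open>g\<close> without leaving the unit interval.\<close>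

lemma mass_le_remove:
  fixes T :: "('k::t2_space \<Rightarrow>\<^sub>C real) \<Rightarrow> ('l::t2_space \<Rightarrow>\<^sub>C real)"
  assumes "linear T" and "mass_le T V y c"
    and "U \<subseteq> V" "G \<subseteq> V" "U \<inter> G = {}"
    and g: "\<And>z. 0 \<le> apply_bcontfun g z" "\<And>z. g z \<le> 1" "\<And>z. z \<notin> G \<Longrightarrow> g z = 0"
    and "d \<le> T g y"
  shows "mass_le T U y (c - d)"
  unfolding mass_le_def
proof (intro allI impI, elim conjE)
  fix h :: "'k \<Rightarrow>\<^sub>C real"
  assume h: "\<forall>z. 0 \<le> apply_bcontfun h z \<and> h z \<le> 1" "\<forall>z. z \<notin> U \<longrightarrow> h z = 0"
  have "h z = 0 \<or> g z = 0" for z using h(2) g(3) assms(5) by blast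
  then have "0 \<le> (h + g) z \<and> (h + g) z \<le> 1" for z
    using h(1) g(1,2) by (metis add.commute add_0 plus_bcontfun.rep_eq)
  moreover have "(h + g) z = 0" if "z \<notin> V" for z
  proof -
    have "z \<notin> U" "z \<notin> G" using that assms(3,4) by auto
    then show ?thesis using h(2) g(3) by simp
  qed
  ultimately have "T (h + g) y \<le> c" using assms(2) by (simp add: mass_le_def)
  with assms(9) show "T h y \<le> c - d"
    by (simp add: linear_add[OF assms(1)])
qed

lemma disjoint_bumps:
  fixes x1 x2 :: "'k::t2_space"
  assumes "compact (UNIV :: 'k set)" and "open V" "x1 \<in> V" "x2 \<in> V" "x1 \<noteq> x2"
  obtains G1 G2 and g1 g2 :: "'k \<Rightarrow>\<^sub>C real"
  where "open G1" "open G2" "G1 \<subseteq> V" "G2 \<subseteq> V" "G1 \<inter> G2 = {}"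
    "\<And>z. 0 \<le> g1 z" "\<And>z. g1 z \<le> 1" "g1 x1 = 1" "\<And>z. z \<notin> G1 \<Longrightarrow> g1 z = 0"
    "\<And>z. 0 \<le> g2 z" "\<And>z. g2 z \<le> 1" "g2 x2 = 1" "\<And>z. z \<notin> G2 \<Longrightarrow> g2 z = 0"
proof -
  obtain A B where AB: "open A" "open B" "x1 \<in> A" "x2 \<in> B" "A \<inter> B = {}"
    using hausdorff[OF assms(5)] by blast
  have o: "open (A \<inter> V)" "x1 \<in> A \<inter> V" "open (B \<inter> V)" "x2 \<in> B \<inter> V" using AB assms by auto
  obtain g1 :: "'k \<Rightarrow>\<^sub>C real"
    where g1: "\<And>z. 0 \<le> g1 z" "\<And>z. g1 z \<le> 1" "g1 x1 = 1" "\<And>z. z \<notin> A \<inter> V \<Longrightarrow> g1 z = 0"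
    using bump_function[OF assms(1) o(1,2)] by blast
  obtain g2 :: "'k \<Rightarrow>\<^sub>C real"
    where g2: "\<And>z. 0 \<le> g2 z" "\<And>z. g2 z \<le> 1" "g2 x2 = 1" "\<And>z. z \<notin> B \<inter> V \<Longrightarrow> g2 z = 0"
    using bump_function[OF assms(1) o(3,4)] by blast
  show ?thesis
    by (rule that[OF o(1,3) _ _ _ g1 g2]) (use AB(5) in auto)
qed

section \<open>Descent on the mass\<close>

lemma split_or_single_valued:
  fixes T :: "('k::t2_space \<Rightarrow>\<^sub>C real) \<Rightarrow> ('l::t2_space \<Rightarrow>\<^sub>C real)"
  assumes "compact (UNIV :: 'k set)" "compact (UNIV :: 'l set)"
    and "linear T" and "0 < m"
    and "open V" "closed F" and cover: "V \<subseteq> atom_relation m T `` F"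
    and mass: "\<And>y. y \<in> F \<Longrightarrow> mass_le T V y c"
  obtains (single) F0 where "closed F0" "V \<subseteq> atom_relation m T `` F0"
      "\<And>y x x'. y \<in> F0 \<Longrightarrow> (y, x) \<in> atom_relation m T \<Longrightarrow> (y, x') \<in> atom_relation m T
        \<Longrightarrow> x \<in> V \<Longrightarrow> x' \<in> V \<Longrightarrow> x = x'"
  | (split) U F1 where "open U" "U \<noteq> {}" "U \<subseteq> V" "closed F1" "U \<subseteq> atom_relation m T `` F1"
      "\<And>y. y \<in> F1 \<Longrightarrow> mass_le T U y (c - m/2)"
proof -
  let ?R = "atom_relation m T"
  obtain F0 where F0: "closed F0" "F0 \<subseteq> F" "V \<subseteq> ?R `` F0"
    and minimal: "\<And>E. closed E \<Longrightarrow> E \<subset> F0 \<Longrightarrow> \<not> V \<subseteq> ?R `` E"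
    using minimal_closed_cover[OF assms(2,1) closed_atom_relation assms(6) cover] by metis
  show thesis
  proof (cases "\<exists>y x x'. y \<in> F0 \<and> (y, x) \<in> ?R \<and> (y, x') \<in> ?R \<and> x \<in> V \<and> x' \<in> V \<and> x \<noteq> x'")
    case False
    then show thesis by (intro single[OF F0(1,3)]) blast
  next
    case True
    then obtain y0 x1 x2 where y0: "y0 \<in> F0" "(y0, x1) \<in> ?R" "(y0, x2) \<in> ?R"
      and x: "x1 \<in> V" "x2 \<in> V" "x1 \<noteq> x2" by blast
    obtain G1 G2 and g1 g2 :: "'k \<Rightarrow>\<^sub>C real"
      where G: "open G1" "open G2" "G1 \<subseteq> V" "G2 \<subseteq> V" "G1 \<inter> G2 = {}"
        and g1: "\<And>z. 0 \<le> g1 z" "\<And>z. g1 z \<le> 1" "g1 x1 = 1" "\<And>z. z \<notin> G1 \<Longrightarrow> g1 z = 0"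
        and g2: "\<And>z. 0 \<le> g2 z" "\<And>z. g2 z \<le> 1" "g2 x2 = 1" "\<And>z. z \<notin> G2 \<Longrightarrow> g2 z = 0"
      using disjoint_bumps[OF assms(1,5) x] by blast
    have "m * g1 x1 \<le> T g1 y0" "m * g2 x2 \<le> T g2 y0"
      using y0(2,3) g1(1) g2(1) by (auto simp: atom_relation_def)
    then have y0_mass: "m/2 < T g1 y0" "m/2 < T g2 y0" using g1(3) g2(3) \<open>0 < m\<close> by auto
    define F1 where "F1 = F0 \<inter> {y. m/2 \<le> T g1 y \<and> m/2 \<le> T g2 y}"
    define E where "E = F0 \<inter> {y. T g1 y \<le> m/2 \<or> T g2 y \<le> m/2}"
    have "closed F1" "closed E"
      unfolding F1_def E_def Collect_conj_eq Collect_disj_eq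
      by (intro closed_Int closed_Un F0 closed_Collect_le continuous_intros; simp)+
    have "y0 \<notin> E" using y0_mass by (simp add: E_def)
    then have "E \<subset> F0" using y0(1) by (auto simp: E_def)
    \<comment> \<open>By minimality \<open>E\<close> leaves part of \<open>V\<close> uncovered, and only points of \<open>F1\<close> can cover that part.\<close>
    define U0 where "U0 = V - ?R `` E"
    have "open U0"
      unfolding U0_def
      by (intro open_Diff assms(5) closed_relation_Image assms(1,2) closed_atom_relation \<open>closed E\<close>)
    have "U0 \<noteq> {}" using minimal[OF \<open>closed E\<close> \<open>E \<subset> F0\<close>] by (auto simp: U0_def)
    have cover1: "U0 \<subseteq> ?R `` F1"
    proof
      fix x assume "x \<in> U0"
      then obtain y where "y \<in> F0" "(y, x) \<in> ?R" "y \<notin> E" using F0(3) by (auto simp: U0_def)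
      then show "x \<in> ?R `` F1" by (auto simp: E_def F1_def)
    qed
    have mass1: "mass_le T V y c" if "y \<in> F1" for y using that F0(2) mass by (auto simp: F1_def)
    show thesis
    proof (cases "U0 \<inter> G1 = {}")
      case True
      have "mass_le T U0 y (c - m/2)" if "y \<in> F1" for y
        by (rule mass_le_remove[where g = g1, OF assms(3) mass1[OF that] _ G(3) True])
          (use g1 that in \<open>auto simp: U0_def F1_def\<close>)
      then show thesis
        using \<open>open U0\<close> \<open>U0 \<noteq> {}\<close> \<open>closed F1\<close> cover1 by (intro split[of U0 F1]) (auto simp: U0_def)
    next
      case False
      have disj: "(U0 \<inter> G1) \<inter> G2 = {}" using G(5) by blast
      have "mass_le T (U0 \<inter> G1) y (c - m/2)" if "y \<in> F1" for y
        by (rule mass_le_remove[where g = g2, OF assms(3) mass1[OF that] _ G(4) disj])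
          (use g2 that in \<open>auto simp: U0_def F1_def\<close>)
      then show thesis
        using \<open>open U0\<close> G(1) False \<open>closed F1\<close> cover1
        by (intro split[of "U0 \<inter> G1" F1]) (auto simp: U0_def)
    qed
  qed
qed

text \<open>
  The number of splittings is bounded by the number of times \<open>m/2\<close> fits into the mass, since
  covering a nonempty open set requires mass at least \<open>m\<close> somewhere.
\<close>

lemma exists_single_valued_cover:
  fixes T :: "('k::t2_space \<Rightarrow>\<^sub>C real) \<Rightarrow> ('l::t2_space \<Rightarrow>\<^sub>C real)"
  assumes "compact (UNIV :: 'k set)" "compact (UNIV :: 'l set)"
    and "linear T" and "0 < m"
    and "open V" "V \<noteq> {}" "closed F" "V \<subseteq> atom_relation m T `` F"
    and "\<And>y. y \<in> F \<Longrightarrow> mass_le T V y c" and "c \<le> real n * (m/2)"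
  shows "\<exists>U F0. open U \<and> U \<noteq> {} \<and> U \<subseteq> V \<and> closed F0 \<and> U \<subseteq> atom_relation m T `` F0 \<and>
    (\<forall>y\<in>F0. \<forall>x\<in>U. \<forall>x'\<in>U. (y, x) \<in> atom_relation m T \<longrightarrow> (y, x') \<in> atom_relation m T \<longrightarrow> x = x')"
  using assms(5-10)
proof (induction n arbitrary: V F c)
  case 0
  then obtain x y where "x \<in> V" "y \<in> F" and xy: "(y, x) \<in> atom_relation m T" by blast
  obtain g :: "'k \<Rightarrow>\<^sub>C real"
    where g: "\<And>z. 0 \<le> g z" "\<And>z. g z \<le> 1" "g x = 1" "\<And>z. z \<notin> V \<Longrightarrow> g z = 0"
    using bump_function[OF assms(1) 0(1) \<open>x \<in> V\<close>] by blast
  have "m * g x \<le> T g y" using xy g(1) by (auto simp: atom_relation_def)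
  moreover have "T g y \<le> c" using 0(5)[OF \<open>y \<in> F\<close>] g by (simp add: mass_le_def)
  ultimately have False using 0(6) g(3) \<open>0 < m\<close> by simp
  then show ?case ..
next
  case (Suc n)
  show ?case
  proof (rule split_or_single_valued[OF assms(1-4) Suc.prems(1,3,4)])
    show "mass_le T V y c" if "y \<in> F" for y using that by (rule Suc.prems(5))
  next
    fix F0
    assume "closed F0" "V \<subseteq> atom_relation m T `` F0"
      and "\<And>y x x'. y \<in> F0 \<Longrightarrow> (y, x) \<in> atom_relation m T \<Longrightarrow> (y, x') \<in> atom_relation m T
        \<Longrightarrow> x \<in> V \<Longrightarrow> x' \<in> V \<Longrightarrow> x = x'"
    with Suc.prems(1,2) show ?case by (intro exI[of _ V] exI[of _ F0]) blast
  next
    fix U F1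
    assume U: "open U" "U \<noteq> {}" "U \<subseteq> V" "closed F1" "U \<subseteq> atom_relation m T `` F1"
      and mass: "\<And>y. y \<in> F1 \<Longrightarrow> mass_le T U y (c - m/2)"
    have "c - m/2 \<le> real n * (m/2)" using Suc.prems(6) by (simp add: field_simps)
    with U(1,2,4,5) mass have "\<exists>W F0. open W \<and> W \<noteq> {} \<and> W \<subseteq> U \<and> closed F0 \<and>
      W \<subseteq> atom_relation m T `` F0 \<and>
      (\<forall>y\<in>F0. \<forall>x\<in>W. \<forall>x'\<in>W. (y, x) \<in> atom_relation m T \<longrightarrow> (y, x') \<in> atom_relation m T \<longrightarrow> x = x')"
      by (rule Suc.IH)
    then show ?case
    proof (elim exE conjE, intro exI conjI)
      fix W assume "W \<subseteq> U"
      then show "W \<subseteq> V" using U(3) by (rule subset_trans)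
    qed
  qed
qed

theorem corollary4p5:
  fixes T :: "('k::t2_space \<Rightarrow>\<^sub>C real) \<Rightarrow> ('l::t2_space \<Rightarrow>\<^sub>C real)"
  assumes "compact (UNIV :: 'k set)"
    and "compact (UNIV :: 'l set)"
    and "isomorphic_embedding T"
    and "positive_operator T"
  shows "pi_base {U :: 'k set. open U \<and> U \<noteq> {} \<and>
           in_ci (top_of_set (closure U)) (euclidean :: 'l topology)}"
proof -
  from assms(3) obtain m M where lin: "linear T" and "0 < m" "0 < M"
    and lower: "\<And>g. m * norm g \<le> norm (T g)" and upper: "\<And>g. norm (T g) \<le> M * norm g"
    unfolding isomorphic_embedding_def by blast
  let ?R = "atom_relation m T"
  have "\<exists>W. open W \<and> W \<noteq> {} \<and> in_ci (top_of_set (closure W)) (euclidean :: 'l topology) \<and> W \<subseteq> V"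
    if V: "open V" "V \<noteq> {}" for V :: "'k set"
  proof -
    have "V \<subseteq> ?R `` UNIV"
      using atom_relation_covers[OF assms(1,2) lin assms(4) \<open>0 < m\<close> lower] by blast
    moreover have "mass_le T V y M" if "y \<in> UNIV" for y
      unfolding mass_le_def
    proof (intro allI impI, elim conjE)
      fix g :: "'k \<Rightarrow>\<^sub>C real"
      assume "\<forall>z. 0 \<le> g z \<and> g z \<le> 1"
      then have "norm g \<le> 1" by (intro norm_bound) simp
      then have "M * norm g \<le> M" using \<open>0 < M\<close> by simp
      then show "T g y \<le> M" using norm_bounded[of "T g" y] upper[of g] by simp
    qed
    moreover obtain n where "M / (m/2) \<le> real n" using real_arch_simple by blast
    then have "M \<le> real n * (m/2)" using \<open>0 < m\<close> by (simp add: pos_divide_le_eq)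
    ultimately have "\<exists>U F. open U \<and> U \<noteq> {} \<and> U \<subseteq> V \<and> closed F \<and> U \<subseteq> ?R `` F \<and>
        (\<forall>y\<in>F. \<forall>x\<in>U. \<forall>x'\<in>U. (y, x) \<in> ?R \<longrightarrow> (y, x') \<in> ?R \<longrightarrow> x = x')"
      by (rule exists_single_valued_cover[OF assms(1,2) lin \<open>0 < m\<close> V closed_UNIV])
    then obtain U F where U: "open U" "U \<noteq> {}" "U \<subseteq> V" "closed F" "U \<subseteq> ?R `` F"
      and single: "\<forall>y\<in>F. \<forall>x\<in>U. \<forall>x'\<in>U. (y, x) \<in> ?R \<longrightarrow> (y, x') \<in> ?R \<longrightarrow> x = x'"
      by metis
    obtain x where "x \<in> U" using U(2) by blast
    obtain W where W: "open W" "x \<in> W" "closure W \<subseteq> U"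
      using shrink_open[OF assms(1) U(1) \<open>x \<in> U\<close>] by blast
    have "in_ci (top_of_set (closure W)) (euclidean :: 'l topology)"
    proof (rule in_ci_of_single_valued[OF assms(2,1) closed_atom_relation U(4) closed_closure])
      show "closure W \<subseteq> ?R `` F" using W(3) U(5) by blast
    qed (use W(3) single in blast)
    then show ?thesis using W U(3) closure_subset[of W] by blast
  qed
  then show ?thesis unfolding pi_base_def by blast
qed

end
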